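(* Consider any instance of the Integrated Process Planning and Scheduling (IPPS) problem and the associated Markov decision process (MDP), both defined in the context. The MDP is equivalent to the IPPS problem in terms of optimal solutions. That is, the minimum makespan over all IPPS solutions of the instance equals the minimum makespan over all complete trajectories of the MDP, and a complete trajectory has minimum makespan among all complete trajectories if and only if the schedule it generates is an optimal (minimum makespan) IPPS solution.
   Context: **IPPS instance.** There is a finite nonempty set of jobs $\mathcal J=\{J_1,\dots,J_n\}$ and a finite nonempty set of machines $\mathcal M=\{M_1,\dots,M_m\}$. Job $J_i$ has a finite nonempty set of operations $\mathcal O_i$. Operation $O_{ij}\in\mathcal O_i$ can be processed on any machine of a given nonempty set $\mathcal M_{ij}\subseteq\mathcal M$. Processing it on $M_k\in\mathcal M_{ij}$ takes time $p_{ijk}>0$. **AND/OR graph.** Each job $J_i$ has an AND/OR graph: a finite directed acyclic graph whose nodes are the operations in $\mathcal O_i$ together with a dummy start node and a dummy end node (the dummies need no processing). Every node lies on a path from start to end. An arc $u\to v$ between operations says that $u$ is an immediate prerequisite of $v$. Some arcs are marked OR (OR-links), and their tails are called OR-connectors. The OR-links leaving an OR-connector lead into at least two pairwise disjoint branches (OR-link paths). Each branch is a nonempty set of operations. All branches of one connector end at a common merge node outside the branches. The only arcs entering a branch from outside come from its connector, and the only arcs leaving it go to its merge node. Branches may contain further OR-connectors, with their branches nested inside, and nested blocks may share a merge node. **Combinations.** A combination of $J_i$ is a set of operations obtained by keeping, for each OR-connector that is itself kept, exactly one of its branches and discarding the others (with everything inside them), and keeping all operations not discarded in this way. All combinations are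 assumed nonempty. $\mathcal C_i$ is the set of all combinations of $J_i$. **IPPS solution.** An IPPS solution consists of a choice of one combination $C_i\in\mathcal C_i$ for each job and, for every operation of every chosen combination, a schedule $d$: an assignment of this operation to one of its machines, with a start time $s(d)\ge 0$ and end time $e(d)=s(d)+(\text{processing time of the operation on that machine})$, such that: (i) if $u\to v$ is an arc and $u,v$ are both in the chosen combination, then $u$ ends no later than $v$ starts; (ii) the intervals $[s(d),e(d))$ of schedules using the same machine are pairwise disjoint; (iii) the intervals $[s(d),e(d))$ of schedules belonging to the same job are pairwise disjoint. The makespan is $\max_d e(d)$. The IPPS problem is to minimize the makespan. **MDP.** A state records the current time $t$ and the partial schedule made so far (the operation-machine assignments and their start times). Initially $t=0$ and nothing is scheduled. A branch of an OR-connector is selected once some operation in it has been scheduled. When a branch is selected, all combinations that contain another branch of the same connector are removed. The combinations not removed so far are called eligible. An unscheduled operation $v$ is feasible if it belongs to at least one eligible combination and every immediate prerequisite operation of $v$ that belongs to at least one eligible combination has been completed (its end time is $\le t$). The available actions are: (a) any pair $(O_{ij},M_k)$ such that $O_{ij}$ is feasible, $M_k\in\mathcal M_{ij}$, and both machine $M_k$ and job $J_i$ are idle at time $t$ (no operation scheduled on that machine, respectively belonging to that job, has end time $>t$). This starts $O_{ij}$ on $M_k$ at time $t$, and the time does not change; (b) "waiting", available if some scheduled operation has end time $>t$. This advances the time to the smallest end time of a scheduled operation that is strictly larger than $t$. A trajectory is complete when, for every job, the set of its scheduled operations is a combination of that job. The schedule generated by a complete trajectory is the resulting collection of operation-machine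 assignments with their start and end times, and the makespan of the trajectory is the maximum of these end times. The objective of the MDP is to minimize the makespan of a complete trajectory. *)

theory Defs
  imports Complex_Main
begin

section \<open>AND/OR graphs and combinations\<close>

datatype 'o node = Start | End | Op 'o

text \<open>
  The arcs and OR-links alone do not determine the branches (two OR-links may lead into the same
  branch), so the branches are part of the data.  \<open>branches G c\<close> is meaningful only if \<open>c\<close> is an
  OR-connector.
\<close>

record 'o and_or_graph =
  opers :: "'o set"
  arcs :: "('o node \<times> 'o node) set"
  or_links :: "('o node \<times> 'o node) set"
  branches :: "'o node \<Rightarrow> 'o set set"

definition nodes :: "'o and_or_graph \<Rightarrow> 'o node set" where
  "nodes G = {Start, End} \<union> Op ` opers G"

definition connectors :: "'o and_or_graph \<Rightarrow> 'o node set" where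
  "connectors G = Domain (or_links G)"

text \<open>
  In \<open>or_block\<close>, the node \<open>w\<close> is the merge node of the connector \<open>c\<close>.  It is not required to be
  distinct from the merge nodes of other connectors.  The start node may be a connector.
\<close>

definition or_block :: "'o and_or_graph \<Rightarrow> 'o node \<Rightarrow> bool" where
  "or_block G c \<longleftrightarrow>
     (\<forall>v. (c, v) \<in> or_links G \<longrightarrow> (\<exists>B \<in> branches G c. v \<in> Op ` B)) \<and>
     (\<exists>B \<in> branches G c. \<exists>B' \<in> branches G c. B \<noteq> B') \<and>
     pairwise disjnt (branches G c) \<and>
     (\<forall>B \<in> branches G c. B \<noteq> {} \<and> B \<subseteq> opers G \<and> (\<exists>v \<in> B. (c, Op v) \<in> or_links G)) \<and>
     (\<forall>B \<in> branches G c. \<forall>v \<in> B. \<forall>u. (u, Op v) \<in> arcs G \<longrightarrow> u \<in> Op ` B \<or> u = c) \<and>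
     (\<exists>w \<in> nodes G. \<forall>B \<in> branches G c.
        w \<notin> Op ` B \<and>
        (\<exists>u \<in> B. (Op u, w) \<in> arcs G) \<and>
        (\<forall>u \<in> B. \<forall>x. (Op u, x) \<in> arcs G \<longrightarrow> x \<in> Op ` B \<or> x = w)) \<and>
     (\<forall>B \<in> branches G c. \<forall>c' \<in> connectors G. c' \<in> Op ` B \<longrightarrow> (\<forall>B' \<in> branches G c'. B' \<subseteq> B))"

definition wf_and_or_graph :: "'o and_or_graph \<Rightarrow> bool" where
  "wf_and_or_graph G \<longleftrightarrow>
     finite (opers G) \<and> opers G \<noteq> {} \<and>
     arcs G \<subseteq> nodes G \<times> nodes G \<and> acyclic (arcs G) \<and>
     (\<forall>v \<in> nodes G. (Start, v) \<in> (arcs G)\<^sup>* \<and> (v, End) \<in> (arcs G)\<^sup>*) \<and>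
     or_links G \<subseteq> arcs G \<and>
     (\<forall>c \<in> connectors G. or_block G c)"

text \<open>Dummy nodes are never discarded.\<close>

definition kept :: "'o set \<Rightarrow> 'o node \<Rightarrow> bool" where
  "kept C x \<longleftrightarrow> (\<forall>v. x = Op v \<longrightarrow> v \<in> C)"

text \<open>
  The function \<open>\<sigma>\<close> gives the branch kept at each kept connector.  The equation for \<open>C\<close> refers to
  \<open>C\<close> on its right-hand side, since only kept connectors discard branches.  In a well-formed graph
  it has exactly one solution for each choice of branches, because every branch of a discarded
  connector lies inside a discarded branch.
\<close>

definition combinations :: "'o and_or_graph \<Rightarrow> 'o set set" where
  "combinations G = {C. \<exists>\<sigma>.
     (\<forall>c \<in> connectors G. kept C c \<longrightarrow> \<sigma> c \<in> branches G c) \<and>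
     C = opers G - \<Union>{B. \<exists>c \<in> connectors G. kept C c \<and> B \<in> branches G c \<and> B \<noteq> \<sigma> c}}"


section \<open>Instances and solutions of the IPPS problem\<close>

text \<open>
  Operations are identified by pairs of a job and an element of \<open>opers\<close> of its graph, so operations
  of different jobs are distinct.
\<close>

record ('j, 'o, 'm) ipps =
  jobs :: "'j set"
  machines :: "'m set"
  graph :: "'j \<Rightarrow> 'o and_or_graph"
  op_machines :: "'j \<Rightarrow> 'o \<Rightarrow> 'm set"
  ptime :: "'j \<Rightarrow> 'o \<Rightarrow> 'm \<Rightarrow> real"

definition ipps_instance :: "('j, 'o, 'm) ipps \<Rightarrow> bool" where
  "ipps_instance I \<longleftrightarrow>
     finite (jobs I) \<and> jobs I \<noteq> {} \<and>
     finite (machines I) \<and> machines I \<noteq> {} \<and>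
     (\<forall>i \<in> jobs I.
        wf_and_or_graph (graph I i) \<and>
        (\<forall>C \<in> combinations (graph I i). C \<noteq> {}) \<and>
        (\<forall>v \<in> opers (graph I i).
           op_machines I i v \<noteq> {} \<and> op_machines I i v \<subseteq> machines I \<and>
           (\<forall>k \<in> op_machines I i v. ptime I i v k > 0)))"

text \<open>A (partial) schedule maps each scheduled operation to its machine and its start time.\<close>

type_synonym ('j, 'o, 'm) sched = "'j \<times> 'o \<rightharpoonup> 'm \<times> real"

definition machine_of :: "('j, 'o, 'm) sched \<Rightarrow> 'j \<times> 'o \<Rightarrow> 'm" where
  "machine_of S x = fst (the (S x))"

definition start_of :: "('j, 'o, 'm) sched \<Rightarrow> 'j \<times> 'o \<Rightarrow> real" where
  "start_of S x = snd (the (S x))"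

definition end_of :: "('j, 'o, 'm) ipps \<Rightarrow> ('j, 'o, 'm) sched \<Rightarrow> 'j \<times> 'o \<Rightarrow> real" where
  "end_of I S x = start_of S x + ptime I (fst x) (snd x) (machine_of S x)"

definition makespan :: "('j, 'o, 'm) ipps \<Rightarrow> ('j, 'o, 'm) sched \<Rightarrow> real" where
  "makespan I S = Max (end_of I S ` dom S)"

definition ipps_solution ::
    "('j, 'o, 'm) ipps \<Rightarrow> ('j \<Rightarrow> 'o set) \<Rightarrow> ('j, 'o, 'm) sched \<Rightarrow> bool" where
  "ipps_solution I C S \<longleftrightarrow>
     (\<forall>i \<in> jobs I. C i \<in> combinations (graph I i)) \<and>
     dom S = (SIGMA i : jobs I. C i) \<and>
     (\<forall>x \<in> dom S. machine_of S x \<in> op_machines I (fst x) (snd x) \<and> start_of S x \<ge> 0) \<and>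
     (\<forall>i \<in> jobs I. \<forall>u \<in> C i. \<forall>v \<in> C i.
        (Op u, Op v) \<in> arcs (graph I i) \<longrightarrow> end_of I S (i, u) \<le> start_of S (i, v)) \<and>
     (\<forall>x \<in> dom S. \<forall>y \<in> dom S. x \<noteq> y \<and> machine_of S x = machine_of S y \<longrightarrow>
        disjnt {start_of S x ..< end_of I S x} {start_of S y ..< end_of I S y}) \<and>
     (\<forall>x \<in> dom S. \<forall>y \<in> dom S. x \<noteq> y \<and> fst x = fst y \<longrightarrow>
        disjnt {start_of S x ..< end_of I S x} {start_of S y ..< end_of I S y})"

text \<open>The chosen combinations can be read off from the domain of the schedule.\<close>

definition ipps_schedule :: "('j, 'o, 'm) ipps \<Rightarrow> ('j, 'o, 'm) sched \<Rightarrow> bool" where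
  "ipps_schedule I S \<longleftrightarrow> (\<exists>C. ipps_solution I C S)"

definition optimal_schedule :: "('j, 'o, 'm) ipps \<Rightarrow> ('j, 'o, 'm) sched \<Rightarrow> bool" where
  "optimal_schedule I S \<longleftrightarrow> is_arg_min (makespan I) (ipps_schedule I) S"


section \<open>The Markov decision process\<close>

record ('j, 'o, 'm) mdp_state =
  time :: real
  sched :: "('j, 'o, 'm) sched"

datatype ('j, 'o, 'm) action = Process 'j 'o 'm | Wait

definition initial_state :: "('j, 'o, 'm) mdp_state" where
  "initial_state = \<lparr>time = 0, sched = Map.empty\<rparr>"

definition scheduled_ops :: "('j, 'o, 'm) mdp_state \<Rightarrow> 'j \<Rightarrow> 'o set" where
  "scheduled_ops s i = {v. (i, v) \<in> dom (sched s)}"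

definition selected :: "('j, 'o, 'm) mdp_state \<Rightarrow> 'j \<Rightarrow> 'o set \<Rightarrow> bool" where
  "selected s i B \<longleftrightarrow> B \<inter> scheduled_ops s i \<noteq> {}"

text \<open>
  A combination \<open>C\<close> contains a branch \<open>B'\<close> if \<open>B'\<close> is kept, that is, if some operation of \<open>B'\<close> is in
  \<open>C\<close>; the inclusion \<open>B' \<subseteq> C\<close> fails as soon as \<open>B'\<close> contains a further connector.
\<close>

definition eligible :: "('j, 'o, 'm) ipps \<Rightarrow> ('j, 'o, 'm) mdp_state \<Rightarrow> 'j \<Rightarrow> 'o set set" where
  "eligible I s i = {C \<in> combinations (graph I i).
     \<not> (\<exists>c \<in> connectors (graph I i).
          \<exists>B \<in> branches (graph I i) c. \<exists>B' \<in> branches (graph I i) c.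
            selected s i B \<and> B' \<noteq> B \<and> B' \<inter> C \<noteq> {})}"

definition feasible :: "('j, 'o, 'm) ipps \<Rightarrow> ('j, 'o, 'm) mdp_state \<Rightarrow> 'j \<Rightarrow> 'o \<Rightarrow> bool" where
  "feasible I s i v \<longleftrightarrow>
     v \<notin> scheduled_ops s i \<and>
     v \<in> \<Union>(eligible I s i) \<and>
     (\<forall>u \<in> \<Union>(eligible I s i). (Op u, Op v) \<in> arcs (graph I i) \<longrightarrow>
        u \<in> scheduled_ops s i \<and> end_of I (sched s) (i, u) \<le> time s)"

definition machine_idle :: "('j, 'o, 'm) ipps \<Rightarrow> ('j, 'o, 'm) mdp_state \<Rightarrow> 'm \<Rightarrow> bool" where
  "machine_idle I s k \<longleftrightarrow>
     (\<forall>x \<in> dom (sched s). machine_of (sched s) x = k \<longrightarrow> end_of I (sched s) x \<le> time s)"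

definition job_idle :: "('j, 'o, 'm) ipps \<Rightarrow> ('j, 'o, 'm) mdp_state \<Rightarrow> 'j \<Rightarrow> bool" where
  "job_idle I s i \<longleftrightarrow>
     (\<forall>x \<in> dom (sched s). fst x = i \<longrightarrow> end_of I (sched s) x \<le> time s)"

definition pending_ends :: "('j, 'o, 'm) ipps \<Rightarrow> ('j, 'o, 'm) mdp_state \<Rightarrow> real set" where
  "pending_ends I s = {e \<in> end_of I (sched s) ` dom (sched s). e > time s}"

fun available ::
    "('j, 'o, 'm) ipps \<Rightarrow> ('j, 'o, 'm) mdp_state \<Rightarrow> ('j, 'o, 'm) action \<Rightarrow> bool" where
  "available I s (Process i v k) \<longleftrightarrow>
     i \<in> jobs I \<and> feasible I s i v \<and> k \<in> op_machines I i v \<and> machine_idle I s k \<and> job_idle I s i"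
| "available I s Wait \<longleftrightarrow> pending_ends I s \<noteq> {}"

fun transition ::
    "('j, 'o, 'm) ipps \<Rightarrow> ('j, 'o, 'm) mdp_state \<Rightarrow> ('j, 'o, 'm) action \<Rightarrow> ('j, 'o, 'm) mdp_state"
  where
  "transition I s (Process i v k) = s\<lparr>sched := (sched s)((i, v) \<mapsto> (k, time s))\<rparr>"
| "transition I s Wait = s\<lparr>time := Min (pending_ends I s)\<rparr>"

text \<open>Transitions are deterministic, so a trajectory is represented by its sequence of actions.\<close>

fun admissible ::
    "('j, 'o, 'm) ipps \<Rightarrow> ('j, 'o, 'm) mdp_state \<Rightarrow> ('j, 'o, 'm) action list \<Rightarrow> bool" where
  "admissible I s [] \<longleftrightarrow> True"
| "admissible I s (a # as) \<longleftrightarrow> available I s a \<and> admissible I (transition I s a) as"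

definition final_state ::
    "('j, 'o, 'm) ipps \<Rightarrow> ('j, 'o, 'm) action list \<Rightarrow> ('j, 'o, 'm) mdp_state" where
  "final_state I \<tau> = foldl (transition I) initial_state \<tau>"

definition complete_trajectory ::
    "('j, 'o, 'm) ipps \<Rightarrow> ('j, 'o, 'm) action list \<Rightarrow> bool" where
  "complete_trajectory I \<tau> \<longleftrightarrow>
     admissible I initial_state \<tau> \<and>
     (\<forall>i \<in> jobs I. scheduled_ops (final_state I \<tau>) i \<in> combinations (graph I i))"

definition generated_schedule ::
    "('j, 'o, 'm) ipps \<Rightarrow> ('j, 'o, 'm) action list \<Rightarrow> ('j, 'o, 'm) sched" where
  "generated_schedule I \<tau> = sched (final_state I \<tau>)"

definition trajectory_makespan ::
    "('j, 'o, 'm) ipps \<Rightarrow> ('j, 'o, 'm) action list \<Rightarrow> real" where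
  "trajectory_makespan I \<tau> = makespan I (generated_schedule I \<tau>)"

definition optimal_trajectory ::
    "('j, 'o, 'm) ipps \<Rightarrow> ('j, 'o, 'm) action list \<Rightarrow> bool" where
  "optimal_trajectory I \<tau> \<longleftrightarrow> is_arg_min (trajectory_makespan I) (complete_trajectory I) \<tau>"

end

theory Submission
  imports Defs
begin

text \<open>
  A complete trajectory generates an IPPS schedule.  The only condition that is not immediate from the
  availability of its actions is the precedence constraint, because feasibility of an operation
  asks only for those prerequisites that lie in some eligible combination.  But the combination
  \<open>C\<close> that is finally scheduled is eligible at every moment of the trajectory: it meets at most one
  branch of each connector, and it contains everything scheduled so far.  So all prerequisites in
  \<open>C\<close> are asked for (\<open>complete_trajectory_ipps_schedule\<close>).

  Conversely, every IPPS schedule \<open>S\<close> is dominated by a complete trajectory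
  (\<open>ipps_schedule_dominated\<close>).  The operations are processed in the order of their start times in
  \<open>S\<close>, each one after waiting for as long as some operation in progress ends no later than the
  start time prescribed by \<open>S\<close>.  By induction no operation starts later than in \<open>S\<close>, hence at the moment
  when the waiting stops the machine and the job are idle and the prerequisites in the combination \<open>C\<close>
  of \<open>S\<close> are completed.  What remains is to see that the MDP does not insist on prerequisites outside
  \<open>C\<close>.  Such a prerequisite \<open>u\<close> of \<open>v\<close> lies in a discarded branch of a kept connector \<open>c\<close>, and \<open>v\<close>
  must be the merge node of \<open>c\<close>.  The kept branch of \<open>c\<close> also contains an immediate prerequisite of
  \<open>v\<close> that is in \<open>C\<close> (\<open>kept_branch_reaches_merge\<close>).  It has been scheduled, so the kept branch is
  selected and no eligible combination contains \<open>u\<close> (\<open>feasible_in_combination\<close>).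

  Both arguments use that branches are nested or disjoint.  This follows from the
  reachability of all nodes from the start node: a nonempty set of operations has an arc entering it,
  and the intersection of two branches could be entered only through both connectors at once.
  As a consequence combinations have a description without self-reference (\<open>combinations_iff\<close>).

  Finally, the minima exist.  An operation is started at most once and each waiting step passes the end of an
  operation, so there are only finitely many trajectories; and any combinations can be
  completed, since a trajectory inside them never gets stuck (\<open>trajectory_progress\<close>).
\<close>

section \<open>Nested branches and combinations\<close>

lemma or_blockD:
  assumes "wf_and_or_graph G" "c \<in> connectors G"
  shows "\<exists>B \<in> branches G c. \<exists>B' \<in> branches G c. B \<noteq> B'"
    and "pairwise disjnt (branches G c)"
    and "\<forall>B \<in> branches G c. B \<noteq> {} \<and> B \<subseteq> opers G \<and> (\<exists>v \<in> B. (c, Op v) \<in> or_links G)"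
    and "\<forall>B \<in> branches G c. \<forall>v \<in> B. \<forall>u. (u, Op v) \<in> arcs G \<longrightarrow> u \<in> Op ` B \<or> u = c"
    and "\<exists>w \<in> nodes G. \<forall>B \<in> branches G c.
        w \<notin> Op ` B \<and> (\<exists>u \<in> B. (Op u, w) \<in> arcs G) \<and>
        (\<forall>u \<in> B. \<forall>x. (Op u, x) \<in> arcs G \<longrightarrow> x \<in> Op ` B \<or> x = w)"
    and "\<forall>B \<in> branches G c. \<forall>c' \<in> connectors G. c' \<in> Op ` B \<longrightarrow> (\<forall>B' \<in> branches G c'. B' \<subseteq> B)"
proof -
  have "or_block G c" using assms by (simp add: wf_and_or_graph_def)
  note block = this[unfolded or_block_def]
  show "\<exists>B \<in> branches G c. \<exists>B' \<in> branches G c. B \<noteq> B'"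
    and "pairwise disjnt (branches G c)"
    and "\<forall>B \<in> branches G c. B \<noteq> {} \<and> B \<subseteq> opers G \<and> (\<exists>v \<in> B. (c, Op v) \<in> or_links G)"
    and "\<forall>B \<in> branches G c. \<forall>v \<in> B. \<forall>u. (u, Op v) \<in> arcs G \<longrightarrow> u \<in> Op ` B \<or> u = c"
    and "\<exists>w \<in> nodes G. \<forall>B \<in> branches G c.
        w \<notin> Op ` B \<and> (\<exists>u \<in> B. (Op u, w) \<in> arcs G) \<and>
        (\<forall>u \<in> B. \<forall>x. (Op u, x) \<in> arcs G \<longrightarrow> x \<in> Op ` B \<or> x = w)"
    and "\<forall>B \<in> branches G c. \<forall>c' \<in> connectors G. c' \<in> Op ` B \<longrightarrow> (\<forall>B' \<in> branches G c'. B' \<subseteq> B)"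
    using block by - (elim conjE, assumption)+
qed

lemma branch_subset_opers:
  assumes "wf_and_or_graph G" "c \<in> connectors G" "B \<in> branches G c"
  shows "B \<subseteq> opers G"
  using or_blockD(3)[OF assms(1,2)] assms(3) by simp

lemma branch_nonempty:
  assumes "wf_and_or_graph G" "c \<in> connectors G" "B \<in> branches G c"
  shows "B \<noteq> {}"
  using or_blockD(3)[OF assms(1,2)] assms(3) by simp

lemma connector_has_branch:
  assumes "wf_and_or_graph G" "c \<in> connectors G"
  shows "\<exists>B. B \<in> branches G c"
  using or_blockD(1)[OF assms] by blast

lemma branches_disjoint:
  assumes "wf_and_or_graph G" "c \<in> connectors G" "B \<in> branches G c" "B' \<in> branches G c" "B \<noteq> B'"
  shows "B \<inter> B' = {}"
  using or_blockD(2)[OF assms(1,2)] assms(3-5) by (simp add: pairwise_def disjnt_def)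

lemma branch_entered_from:
  assumes "wf_and_or_graph G" "c \<in> connectors G" "B \<in> branches G c" "v \<in> B" "(u, Op v) \<in> arcs G"
  shows "u \<in> Op ` B \<or> u = c"
  using or_blockD(4)[OF assms(1,2)] assms(3-5) by simp

lemma merge_node:
  assumes "wf_and_or_graph G" "c \<in> connectors G"
  obtains w where "\<And>B. B \<in> branches G c \<Longrightarrow> w \<notin> Op ` B"
    and "\<And>B. B \<in> branches G c \<Longrightarrow> \<exists>u \<in> B. (Op u, w) \<in> arcs G"
    and "\<And>B u x. B \<in> branches G c \<Longrightarrow> u \<in> B \<Longrightarrow> (Op u, x) \<in> arcs G \<Longrightarrow> x \<in> Op ` B \<or> x = w"
proof -
  from or_blockD(5)[OF assms] obtain w where w: "\<forall>B \<in> branches G c.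
      w \<notin> Op ` B \<and> (\<exists>u \<in> B. (Op u, w) \<in> arcs G) \<and>
      (\<forall>u \<in> B. \<forall>x. (Op u, x) \<in> arcs G \<longrightarrow> x \<in> Op ` B \<or> x = w)" by (elim bexE)
  show ?thesis by (rule that[of w]) (simp_all add: w)
qed

lemma nested_branch_subset:
  assumes "wf_and_or_graph G" "c \<in> connectors G" "B \<in> branches G c"
    and "c' \<in> connectors G" "c' \<in> Op ` B" "B' \<in> branches G c'"
  shows "B' \<subseteq> B"
  using or_blockD(6)[OF assms(1,2)] assms(3-6) by blast

text \<open>Otherwise no path from the start node, which is not an operation, would reach \<open>X\<close>.\<close>

lemma arc_entering:
  assumes wf: "wf_and_or_graph G" and X: "X \<subseteq> opers G" "X \<noteq> {}"
  shows "\<exists>u. \<exists>v \<in> X. (u, Op v) \<in> arcs G \<and> u \<notin> Op ` X"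
proof (rule ccontr)
  assume no: "\<not> ?thesis"
  obtain v where v: "v \<in> X" using X by blast
  then have "(Start, Op v) \<in> (arcs G)\<^sup>*"
    using wf X by (auto simp: wf_and_or_graph_def nodes_def)
  then have "Start \<in> Op ` X"
    by (induction rule: converse_rtrancl_induct) (use v no in auto)
  then show False by auto
qed

lemma connector_not_in_own_branch:
  assumes "wf_and_or_graph G" "c \<in> connectors G" "B \<in> branches G c"
  shows "c \<notin> Op ` B"
  using arc_entering[OF assms(1) branch_subset_opers[OF assms] branch_nonempty[OF assms]]
    branch_entered_from[OF assms] by blast

text \<open>
  An arc entering the intersection of the two branches starts in \<open>B\<close> or at \<open>c\<close>, and in \<open>B'\<close> or at
  \<open>c'\<close>; since it starts outside the intersection, one connector lies in the branch of the other.
\<close>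

lemma overlapping_branches_nested:
  assumes wf: "wf_and_or_graph G"
    and B: "c \<in> connectors G" "B \<in> branches G c"
    and B': "c' \<in> connectors G" "B' \<in> branches G c'"
    and overlap: "B \<inter> B' \<noteq> {}" and ne: "c \<noteq> c'"
  shows "c \<in> Op ` B' \<or> c' \<in> Op ` B"
proof -
  have "B \<inter> B' \<subseteq> opers G" using branch_subset_opers[OF wf B] by blast
  from arc_entering[OF wf this overlap] obtain u v
    where uv: "v \<in> B \<inter> B'" "(u, Op v) \<in> arcs G" "u \<notin> Op ` (B \<inter> B')" by blast
  have "u \<in> Op ` B \<or> u = c" "u \<in> Op ` B' \<or> u = c'"
    using branch_entered_from[OF wf B _ uv(2)] branch_entered_from[OF wf B' _ uv(2)] uv(1) by auto
  then show ?thesis using uv(3) ne by auto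
qed

text \<open>Here discarded connectors discard their branches as well, unlike in \<open>combinations\<close>.\<close>

definition discarded :: "'o and_or_graph \<Rightarrow> ('o node \<Rightarrow> 'o set) \<Rightarrow> 'o set" where
  "discarded G \<sigma> = \<Union>{B. \<exists>c \<in> connectors G. B \<in> branches G c \<and> B \<noteq> \<sigma> c}"

definition branch_choice :: "'o and_or_graph \<Rightarrow> ('o node \<Rightarrow> 'o set) \<Rightarrow> bool" where
  "branch_choice G \<sigma> \<longleftrightarrow> (\<forall>c \<in> connectors G. \<sigma> c \<in> branches G c)"

lemma unchosen_branch_discarded:
  "c \<in> connectors G \<Longrightarrow> B \<in> branches G c \<Longrightarrow> B \<noteq> \<sigma> c \<Longrightarrow> B \<subseteq> discarded G \<sigma>"
  by (auto simp: discarded_def)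

lemma kept_iff_not_discarded:
  assumes "wf_and_or_graph G" "c \<in> connectors G"
  shows "kept (opers G - D) c \<longleftrightarrow> c \<notin> Op ` D"
proof -
  have "c \<in> nodes G"
    using assms by (auto simp: wf_and_or_graph_def connectors_def)
  then show ?thesis by (auto simp: kept_def nodes_def)
qed

text \<open>
  A largest discarded branch around \<open>v\<close> has a kept connector, since otherwise the branch that
  discards this connector would be larger.
\<close>

lemma discarded_by_kept_connector:
  assumes wf: "wf_and_or_graph G" and v: "v \<in> discarded G \<sigma>"
  obtains c B where "c \<in> connectors G" "B \<in> branches G c" "B \<noteq> \<sigma> c" "v \<in> B"
    "c \<notin> Op ` discarded G \<sigma>"
proof -
  define P where "P B \<longleftrightarrow> v \<in> B \<and> (\<exists>c \<in> connectors G. B \<in> branches G c \<and> B \<noteq> \<sigma> c)" for B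
  have fin: "finite (opers G)" using wf by (simp add: wf_and_or_graph_def)
  have sub: "B \<subseteq> opers G" if "P B" for B
    using that branch_subset_opers[OF wf] by (auto simp: P_def)
  obtain B0 where "P B0" using v by (auto simp: P_def discarded_def)
  moreover have "\<forall>B. P B \<longrightarrow> card B < Suc (card (opers G))"
    using card_mono[OF fin sub] by (simp add: less_Suc_eq_le)
  ultimately obtain B where B: "P B" and max: "\<And>B'. P B' \<Longrightarrow> card B' \<le> card B"
    using ex_has_greatest_nat[of P B0 card "Suc (card (opers G))"] by blast
  obtain c where c: "c \<in> connectors G" "B \<in> branches G c" "B \<noteq> \<sigma> c"
    using B by (auto simp: P_def)
  have "c \<notin> Op ` discarded G \<sigma>"
  proof
    assume "c \<in> Op ` discarded G \<sigma>"
    then obtain c1 B1 where B1: "c1 \<in> connectors G" "B1 \<in> branches G c1" "B1 \<noteq> \<sigma> c1" "c \<in> Op ` B1"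
      by (auto simp: discarded_def)
    have "B \<subseteq> B1" using nested_branch_subset[OF wf B1(1,2) c(1) B1(4) c(2)] .
    moreover have "B \<noteq> B1" using connector_not_in_own_branch[OF wf c(1,2)] B1(4) by blast
    moreover have "P B1" using \<open>B \<subseteq> B1\<close> B B1 by (auto simp: P_def)
    ultimately show False
      using max[of B1] psubset_card_mono[of B1 B] finite_subset[OF sub fin] by fastforce
  qed
  then show ?thesis using that c B by (auto simp: P_def)
qed

text \<open>
  The self-reference in the definition of a combination disappears because the branches of a
  discarded connector lie inside a discarded branch: whether or not they are discarded
  explicitly, and whichever of them is chosen, the union of the discarded branches is the same.
\<close>

lemma combinations_iff:
  assumes wf: "wf_and_or_graph G"
  shows "C \<in> combinations G \<longleftrightarrow> (\<exists>\<sigma>. branch_choice G \<sigma> \<and> C = opers G - discarded G \<sigma>)"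
proof
  assume "C \<in> combinations G"
  then obtain \<sigma> where \<sigma>: "\<forall>c \<in> connectors G. kept C c \<longrightarrow> \<sigma> c \<in> branches G c"
    and C: "C = opers G - \<Union>{B. \<exists>c \<in> connectors G. kept C c \<and> B \<in> branches G c \<and> B \<noteq> \<sigma> c}"
      (is "_ = _ - ?D")
    by (auto simp: combinations_def)
  \<comment> \<open>The given \<open>\<sigma>\<close> is unconstrained at discarded connectors, so it is replaced there by any choice.\<close>
  define \<sigma>' where "\<sigma>' c = (if kept C c then \<sigma> c else SOME B. B \<in> branches G c)" for c
  have "\<sigma>' c \<in> branches G c" if "c \<in> connectors G" for c
    using \<sigma> that someI_ex[OF connector_has_branch[OF wf that]] by (simp add: \<sigma>'_def)
  then have choice: "branch_choice G \<sigma>'" by (simp add: branch_choice_def)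
  have "?D \<subseteq> discarded G \<sigma>'"
    by (auto simp: discarded_def \<sigma>'_def)
  moreover have "discarded G \<sigma>' \<subseteq> ?D"
  proof
    fix v assume "v \<in> discarded G \<sigma>'"
    then obtain c B where c: "c \<in> connectors G" "B \<in> branches G c" "B \<noteq> \<sigma>' c" "v \<in> B"
      by (auto simp: discarded_def)
    show "v \<in> ?D"
    proof (cases "kept C c")
      case True
      then show ?thesis using c by (auto simp: \<sigma>'_def)
    next
      case False
      then have "c \<in> Op ` ?D" using kept_iff_not_discarded[OF wf c(1), of ?D] C by simp
      then obtain c1 B1 where 1: "c1 \<in> connectors G" "kept C c1" "B1 \<in> branches G c1" "B1 \<noteq> \<sigma> c1"
        "c \<in> Op ` B1" by blast
      then have "B \<subseteq> B1" using nested_branch_subset[OF wf 1(1,3) c(1) 1(5) c(2)] by simp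
      then show ?thesis using 1 c by blast
    qed
  qed
  ultimately show "\<exists>\<sigma>. branch_choice G \<sigma> \<and> C = opers G - discarded G \<sigma>"
    using choice C by (intro exI[of _ \<sigma>']) auto
next
  assume "\<exists>\<sigma>. branch_choice G \<sigma> \<and> C = opers G - discarded G \<sigma>"
  then obtain \<sigma> where \<sigma>: "branch_choice G \<sigma>" and C: "C = opers G - discarded G \<sigma>" by blast
  have D: "discarded G \<sigma> = \<Union>{B. \<exists>c \<in> connectors G. kept C c \<and> B \<in> branches G c \<and> B \<noteq> \<sigma> c}"
    (is "_ = ?D")
  proof
    show "discarded G \<sigma> \<subseteq> ?D"
    proof
      fix v assume "v \<in> discarded G \<sigma>"
      then obtain c B where c: "c \<in> connectors G" "B \<in> branches G c" "B \<noteq> \<sigma> c" "v \<in> B"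
        "c \<notin> Op ` discarded G \<sigma>"
        by (rule discarded_by_kept_connector[OF wf])
      then show "v \<in> ?D" using kept_iff_not_discarded[OF wf c(1), of "discarded G \<sigma>"] C by blast
    qed
  qed (auto simp: discarded_def)
  have "C = opers G - ?D" using C unfolding D .
  moreover have "\<forall>c \<in> connectors G. kept C c \<longrightarrow> \<sigma> c \<in> branches G c"
    using \<sigma> by (simp add: branch_choice_def)
  ultimately show "C \<in> combinations G"
    unfolding combinations_def by (intro CollectI exI[of _ \<sigma>] conjI)
qed

lemma combination_exists:
  assumes wf: "wf_and_or_graph G"
  shows "\<exists>C. C \<in> combinations G"
proof -
  let ?\<sigma> = "\<lambda>c. SOME B. B \<in> branches G c"
  have "branch_choice G ?\<sigma>"
    unfolding branch_choice_def
  proof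
    fix c assume "c \<in> connectors G"
    from connector_has_branch[OF wf this] show "?\<sigma> c \<in> branches G c" by (rule someI_ex)
  qed
  then have "opers G - discarded G ?\<sigma> \<in> combinations G"
    unfolding combinations_iff[OF wf] by (intro exI[of _ ?\<sigma>]) simp
  then show ?thesis ..
qed

lemma combination_subset_opers: "C \<in> combinations G \<Longrightarrow> C \<subseteq> opers G"
  by (auto simp: combinations_def)

lemma combination_meets_one_branch:
  assumes wf: "wf_and_or_graph G" and C: "C \<in> combinations G" and c: "c \<in> connectors G"
    and B: "B \<in> branches G c" "B \<inter> C \<noteq> {}" and B': "B' \<in> branches G c" "B' \<inter> C \<noteq> {}"
  shows "B = B'"
proof -
  obtain \<sigma> where \<sigma>: "C = opers G - discarded G \<sigma>"
    using C combinations_iff[OF wf] by blast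
  have "B = \<sigma> c" using unchosen_branch_discarded[OF c B(1), of \<sigma>] B(2) \<sigma> by blast
  moreover have "B' = \<sigma> c" using unchosen_branch_discarded[OF c B'(1), of \<sigma>] B'(2) \<sigma> by blast
  ultimately show ?thesis by simp
qed

text \<open>
  A branch has an arc to the merge node, but its tail may be discarded.  The tail then lies in a
  discarded branch of a kept connector nested inside.  The merge node of that connector must be
  \<open>w\<close> too, and its kept branch is a smaller branch with an arc to \<open>w\<close>.
\<close>

lemma kept_branch_reaches_merge:
  assumes wf: "wf_and_or_graph G" and choice: "branch_choice G \<sigma>"
    and c: "c \<in> connectors G" "c \<notin> Op ` discarded G \<sigma>"
    and w: "\<And>B. B \<in> branches G c \<Longrightarrow> w \<notin> Op ` B"
      "\<And>B. B \<in> branches G c \<Longrightarrow> \<exists>u \<in> B. (Op u, w) \<in> arcs G"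
  shows "\<exists>u \<in> \<sigma> c. u \<notin> discarded G \<sigma> \<and> (Op u, w) \<in> arcs G"
  using c w
proof (induction "card (\<sigma> c)" arbitrary: c rule: less_induct)
  case less
  have \<sigma>c: "\<sigma> c \<in> branches G c" using choice less.prems by (simp add: branch_choice_def)
  obtain u where u: "u \<in> \<sigma> c" "(Op u, w) \<in> arcs G" using less.prems(4)[OF \<sigma>c] by blast
  show ?case
  proof (cases "u \<in> discarded G \<sigma>")
    case False
    then show ?thesis using u by blast
  next
    case True
    obtain c1 B1 where 1: "c1 \<in> connectors G" "B1 \<in> branches G c1" "B1 \<noteq> \<sigma> c1" "u \<in> B1"
      "c1 \<notin> Op ` discarded G \<sigma>"
      using True by (rule discarded_by_kept_connector[OF wf])
    have \<sigma>c1: "\<sigma> c1 \<in> branches G c1" using choice 1 by (simp add: branch_choice_def)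
    have "c \<noteq> c1" using branches_disjoint[OF wf 1(1,2) \<sigma>c1 1(3)] 1(4) u(1) by blast
    moreover have "c \<notin> Op ` B1" using less.prems(2) unchosen_branch_discarded[of c1 G B1 \<sigma>] 1 by blast
    ultimately have c1_in: "c1 \<in> Op ` \<sigma> c"
      using overlapping_branches_nested[OF wf less.prems(1) \<sigma>c 1(1,2)] u(1) 1(4) by blast
    have nested: "B \<subseteq> \<sigma> c" if "B \<in> branches G c1" for B
      using nested_branch_subset[OF wf less.prems(1) \<sigma>c 1(1) c1_in that] .
    obtain w1 where w1: "\<And>B. B \<in> branches G c1 \<Longrightarrow> w1 \<notin> Op ` B"
      "\<And>B. B \<in> branches G c1 \<Longrightarrow> \<exists>u \<in> B. (Op u, w1) \<in> arcs G"
      and leave: "\<And>B u x. B \<in> branches G c1 \<Longrightarrow> u \<in> B \<Longrightarrow> (Op u, x) \<in> arcs G \<Longrightarrow>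
        x \<in> Op ` B \<or> x = w1"
      using merge_node[OF wf 1(1)] by blast
    have "w \<notin> Op ` B1" using less.prems(3)[OF \<sigma>c] nested[OF 1(2)] by blast
    then have "w = w1" using leave[OF 1(2,4) u(2)] by simp
    have "\<sigma> c1 \<noteq> \<sigma> c" using connector_not_in_own_branch[OF wf 1(1) \<sigma>c1] c1_in by auto
    moreover have "finite (\<sigma> c)"
      using branch_subset_opers[OF wf less.prems(1) \<sigma>c] wf
      by (auto simp: wf_and_or_graph_def intro: finite_subset)
    ultimately have "card (\<sigma> c1) < card (\<sigma> c)"
      using nested[OF \<sigma>c1] by (intro psubset_card_mono) auto
    then have "\<exists>u \<in> \<sigma> c1. u \<notin> discarded G \<sigma> \<and> (Op u, w) \<in> arcs G"
      using less.hyps[OF _ 1(1,5)] w1 \<open>w = w1\<close> by simp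
    then show ?thesis using nested[OF \<sigma>c1] by blast
  qed
qed


section \<open>Eligibility and feasibility inside a combination\<close>

lemma combination_eligible:
  assumes "wf_and_or_graph (graph I i)" "C \<in> combinations (graph I i)" "scheduled_ops s i \<subseteq> C"
  shows "C \<in> eligible I s i"
  using assms combination_meets_one_branch[OF assms(1,2)]
  unfolding eligible_def selected_def by blast

text \<open>
  An immediate prerequisite outside \<open>C\<close> lies in a discarded branch with merge node \<open>v\<close>.  The kept
  branch of the same connector is already selected, because one of its operations in \<open>C\<close> is a
  prerequisite of \<open>v\<close> too.
\<close>

lemma feasible_in_combination:
  assumes wf: "wf_and_or_graph (graph I i)" and C: "C \<in> combinations (graph I i)"
    and sub: "scheduled_ops s i \<subseteq> C" and v: "v \<in> C" "v \<notin> scheduled_ops s i"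
    and completed: "\<And>u. u \<in> C \<Longrightarrow> (Op u, Op v) \<in> arcs (graph I i) \<Longrightarrow>
      u \<in> scheduled_ops s i \<and> end_of I (sched s) (i, u) \<le> time s"
  shows "feasible I s i v"
proof -
  let ?G = "graph I i"
  obtain \<sigma> where choice: "branch_choice ?G \<sigma>" and C_eq: "C = opers ?G - discarded ?G \<sigma>"
    using C combinations_iff[OF wf] by blast
  have "u \<in> C" if u: "u \<in> E" "E \<in> eligible I s i" and arc: "(Op u, Op v) \<in> arcs ?G" for u E
  proof (rule ccontr)
    assume "u \<notin> C"
    moreover have "u \<in> opers ?G"
      using u combination_subset_opers by (auto simp: eligible_def)
    ultimately have "u \<in> discarded ?G \<sigma>" using C_eq by blast
    then obtain c B where c: "c \<in> connectors ?G" "B \<in> branches ?G c" "B \<noteq> \<sigma> c" "u \<in> B"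
      "c \<notin> Op ` discarded ?G \<sigma>" by (rule discarded_by_kept_connector[OF wf])
    obtain w where w: "\<And>B. B \<in> branches ?G c \<Longrightarrow> w \<notin> Op ` B"
      "\<And>B. B \<in> branches ?G c \<Longrightarrow> \<exists>u \<in> B. (Op u, w) \<in> arcs ?G"
      and leave: "\<And>B u x. B \<in> branches ?G c \<Longrightarrow> u \<in> B \<Longrightarrow> (Op u, x) \<in> arcs ?G \<Longrightarrow>
        x \<in> Op ` B \<or> x = w"
      using merge_node[OF wf c(1)] by blast
    have "v \<notin> B" using v(1) C_eq unchosen_branch_discarded[OF c(1,2), of \<sigma>] c(3) by blast
    then have "Op v \<notin> Op ` B" by blast
    then have "w = Op v" using leave[OF c(2,4) arc] by simp
    obtain u' where u': "u' \<in> \<sigma> c" "u' \<notin> discarded ?G \<sigma>" "(Op u', w) \<in> arcs ?G"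
      using kept_branch_reaches_merge[OF wf choice c(1,5) w] by blast
    have \<sigma>c: "\<sigma> c \<in> branches ?G c" using choice c by (simp add: branch_choice_def)
    then have "u' \<in> C" using u' branch_subset_opers[OF wf c(1)] C_eq by blast
    then have "selected s i (\<sigma> c)"
      using completed u' \<open>w = Op v\<close> by (auto simp: selected_def)
    then show False using u c \<sigma>c unfolding eligible_def by blast
  qed
  then show ?thesis
    using combination_eligible[OF wf C sub] v completed unfolding feasible_def by blast
qed


section \<open>Runs of the decision process\<close>

abbreviation run :: "('j, 'o, 'm) ipps \<Rightarrow> ('j, 'o, 'm) mdp_state \<Rightarrow> ('j, 'o, 'm) action list \<Rightarrow>
    ('j, 'o, 'm) mdp_state" where
  "run I \<equiv> foldl (transition I)"

definition combination_choice :: "('j, 'o, 'm) ipps \<Rightarrow> ('j \<Rightarrow> 'o set) \<Rightarrow> bool" where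
  "combination_choice I C \<longleftrightarrow> (\<forall>i \<in> jobs I. C i \<in> combinations (graph I i))"

definition all_ops :: "('j, 'o, 'm) ipps \<Rightarrow> ('j \<times> 'o) set" where
  "all_ops I = (SIGMA i : jobs I. opers (graph I i))"

lemma instance_graph_wf: "ipps_instance I \<Longrightarrow> i \<in> jobs I \<Longrightarrow> wf_and_or_graph (graph I i)"
  by (simp add: ipps_instance_def)

lemma finite_all_ops: "ipps_instance I \<Longrightarrow> finite (all_ops I)"
  by (auto simp: all_ops_def ipps_instance_def wf_and_or_graph_def)

lemma combination_choice_subset_all_ops:
  "combination_choice I C \<Longrightarrow> Sigma (jobs I) C \<subseteq> all_ops I"
  using combination_subset_opers by (fastforce simp: combination_choice_def all_ops_def)

lemma admissible_append:
  "admissible I s (as @ bs) \<longleftrightarrow> admissible I s as \<and> admissible I (run I s as) bs"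
  by (induction as arbitrary: s) auto

lemma machine_of_upd [simp]: "machine_of (S(x \<mapsto> (k, t))) y = (if y = x then k else machine_of S y)"
  by (simp add: machine_of_def)

lemma start_of_upd [simp]: "start_of (S(x \<mapsto> (k, t))) y = (if y = x then t else start_of S y)"
  by (simp add: start_of_def)

lemma end_of_upd [simp]: "end_of I (S(x \<mapsto> (k, t))) y =
    (if y = x then t + ptime I (fst x) (snd x) k else end_of I S y)"
  by (simp add: end_of_def)

lemma feasible_in_opers: "feasible I s i v \<Longrightarrow> v \<in> opers (graph I i)"
  using combination_subset_opers by (fastforce simp: feasible_def eligible_def)

lemma finite_pending_ends: "finite (dom (sched s)) \<Longrightarrow> finite (pending_ends I s)"
  by (simp add: pending_ends_def)

lemma wait_time:
  assumes "finite (dom (sched s))" "available I s Wait"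
  shows "Min (pending_ends I s) \<in> pending_ends I s"
  using assms(2) Min_in[OF finite_pending_ends[OF assms(1)]] by simp

lemma pending_ends_later:
  assumes "t \<in> pending_ends I s"
  shows "pending_ends I (s\<lparr>time := t\<rparr>) \<subset> pending_ends I s"
proof -
  have "t \<notin> pending_ends I (s\<lparr>time := t\<rparr>)" by (simp add: pending_ends_def)
  moreover have "time s < t" using assms by (simp add: pending_ends_def)
  then have "pending_ends I (s\<lparr>time := t\<rparr>) \<subseteq> pending_ends I s"
    by (auto simp: pending_ends_def)
  ultimately show ?thesis using assms by blast
qed

lemma dom_transition_mono: "dom (sched s) \<subseteq> dom (sched (transition I s a))"
  by (cases a) auto

section \<open>Complete trajectories generate IPPS schedules\<close>

text \<open>
  The conditions of an IPPS solution for the operations scheduled so far, relative to combinations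
  \<open>C\<close> that the trajectory stays in.  The prerequisites in \<open>C\<close> of a scheduled operation must
  themselves be scheduled: one that is still missing could only start after the operation.
\<close>

definition partial_solution ::
    "('j, 'o, 'm) ipps \<Rightarrow> ('j \<Rightarrow> 'o set) \<Rightarrow> ('j, 'o, 'm) mdp_state \<Rightarrow> bool" where
  "partial_solution I C s \<longleftrightarrow>
     time s \<ge> 0 \<and> dom (sched s) \<subseteq> Sigma (jobs I) C \<and>
     (\<forall>x \<in> dom (sched s). machine_of (sched s) x \<in> op_machines I (fst x) (snd x) \<and>
        start_of (sched s) x \<ge> 0) \<and>
     (\<forall>i v u. (i, v) \<in> dom (sched s) \<longrightarrow> u \<in> C i \<longrightarrow> (Op u, Op v) \<in> arcs (graph I i) \<longrightarrow>
        (i, u) \<in> dom (sched s) \<and> end_of I (sched s) (i, u) \<le> start_of (sched s) (i, v)) \<and>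
     (\<forall>x \<in> dom (sched s). \<forall>y \<in> dom (sched s).
        x \<noteq> y \<and> (machine_of (sched s) x = machine_of (sched s) y \<or> fst x = fst y) \<longrightarrow>
        disjnt {start_of (sched s) x ..< end_of I (sched s) x}
               {start_of (sched s) y ..< end_of I (sched s) y})"

lemma partial_solutionD:
  assumes "partial_solution I C s"
  shows "time s \<ge> 0" "dom (sched s) \<subseteq> Sigma (jobs I) C"
    and "\<forall>x \<in> dom (sched s). machine_of (sched s) x \<in> op_machines I (fst x) (snd x) \<and>
        start_of (sched s) x \<ge> 0"
    and "\<forall>i v u. (i, v) \<in> dom (sched s) \<longrightarrow> u \<in> C i \<longrightarrow> (Op u, Op v) \<in> arcs (graph I i) \<longrightarrow>
        (i, u) \<in> dom (sched s) \<and> end_of I (sched s) (i, u) \<le> start_of (sched s) (i, v)"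
    and "\<forall>x \<in> dom (sched s). \<forall>y \<in> dom (sched s).
        x \<noteq> y \<and> (machine_of (sched s) x = machine_of (sched s) y \<or> fst x = fst y) \<longrightarrow>
        disjnt {start_of (sched s) x ..< end_of I (sched s) x}
               {start_of (sched s) y ..< end_of I (sched s) y}"
  using assms unfolding partial_solution_def by - (elim conjE, assumption)+

lemma disjnt_later_interval:
  fixes a b t e :: real
  assumes "b \<le> t"
  shows "disjnt {a ..< b} {t ..< e}" "disjnt {t ..< e} {a ..< b}"
  using assms by (auto simp: disjnt_def)

lemma partial_solution_transition:
  assumes inst: "ipps_instance I" and C: "combination_choice I C"
    and s: "partial_solution I C s" and a: "available I s a"
    and sub: "dom (sched (transition I s a)) \<subseteq> Sigma (jobs I) C"
  shows "partial_solution I C (transition I s a)"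
proof (cases a)
  case Wait
  have "finite (dom (sched s))"
    using subset_trans[OF partial_solutionD(2)[OF s] combination_choice_subset_all_ops[OF C]]
      finite_all_ops[OF inst] by (rule finite_subset)
  then have "Min (pending_ends I s) > time s"
    using wait_time[of s I] a Wait by (simp add: pending_ends_def)
  then have "time (transition I s a) \<ge> 0" using partial_solutionD(1)[OF s] Wait by simp
  moreover have "sched (transition I s a) = sched s" using Wait by simp
  ultimately show ?thesis
    using partial_solutionD(2-5)[OF s] unfolding partial_solution_def by (intro conjI) simp_all
next
  case (Process i v k)
  have i: "i \<in> jobs I" and feas: "feasible I s i v" and k: "k \<in> op_machines I i v"
    and mi: "machine_idle I s k" and ji: "job_idle I s i"
    using a Process by auto
  have new: "(i, v) \<notin> dom (sched s)" using feas by (simp add: feasible_def scheduled_ops_def)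
  have sched_sub: "scheduled_ops s i \<subseteq> C i"
    using partial_solutionD(2)[OF s] by (auto simp: scheduled_ops_def)
  \<comment> \<open>As \<open>C i\<close> is eligible, the MDP asks for all prerequisites of \<open>v\<close> in \<open>C i\<close>.\<close>
  have "C i \<in> eligible I s i"
    using combination_eligible[OF instance_graph_wf[OF inst i] _ sched_sub] C i
    by (simp add: combination_choice_def)
  then have pre: "(i, u) \<in> dom (sched s) \<and> end_of I (sched s) (i, u) \<le> time s"
    if "u \<in> C i" "(Op u, Op v) \<in> arcs (graph I i)" for u
    using feas that by (auto simp: feasible_def scheduled_ops_def)
  have old: "end_of I (sched s) x \<le> time s"
    if "x \<in> dom (sched s)" "machine_of (sched s) x = k \<or> fst x = i" for x
    using that mi ji by (auto simp: machine_idle_def job_idle_def)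
  let ?s = "transition I s a"
  have dom': "dom (sched ?s) = insert (i, v) (dom (sched s))" using Process by auto
  show ?thesis
    unfolding partial_solution_def
  proof (intro conjI)
    show "0 \<le> time ?s" using partial_solutionD(1)[OF s] Process by simp
    show "dom (sched ?s) \<subseteq> Sigma (jobs I) C" by (rule sub)
    show "\<forall>x \<in> dom (sched ?s). machine_of (sched ?s) x \<in> op_machines I (fst x) (snd x) \<and>
        0 \<le> start_of (sched ?s) x"
      unfolding dom' using partial_solutionD(1,3)[OF s] Process k by simp
    show "\<forall>i v u. (i, v) \<in> dom (sched ?s) \<longrightarrow> u \<in> C i \<longrightarrow> (Op u, Op v) \<in> arcs (graph I i) \<longrightarrow>
        (i, u) \<in> dom (sched ?s) \<and> end_of I (sched ?s) (i, u) \<le> start_of (sched ?s) (i, v)"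
    proof (intro allI impI)
      fix i' v' u
      assume *: "(i', v') \<in> dom (sched ?s)" "u \<in> C i'" "(Op u, Op v') \<in> arcs (graph I i')"
      show "(i', u) \<in> dom (sched ?s) \<and> end_of I (sched ?s) (i', u) \<le> start_of (sched ?s) (i', v')"
      proof (cases "(i', v') = (i, v)")
        case True
        have "(i, u) \<in> dom (sched s) \<and> end_of I (sched s) (i, u) \<le> time s"
          using * True pre by auto
        then show ?thesis using True new Process by auto
      next
        case False
        then have "(i', v') \<in> dom (sched s)" using *(1) unfolding dom' by auto
        then have "(i', u) \<in> dom (sched s) \<and>
            end_of I (sched s) (i', u) \<le> start_of (sched s) (i', v')"
          using partial_solutionD(4)[OF s] *(2,3) by blast
        then show ?thesis using False new Process by auto
      qed
    qed
    show "\<forall>x \<in> dom (sched ?s). \<forall>y \<in> dom (sched ?s).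
        x \<noteq> y \<and> (machine_of (sched ?s) x = machine_of (sched ?s) y \<or> fst x = fst y) \<longrightarrow>
        disjnt {start_of (sched ?s) x ..< end_of I (sched ?s) x}
               {start_of (sched ?s) y ..< end_of I (sched ?s) y}"
    proof (intro ballI impI)
      fix x y
      assume xy: "x \<in> dom (sched ?s)" "y \<in> dom (sched ?s)"
        and *: "x \<noteq> y \<and> (machine_of (sched ?s) x = machine_of (sched ?s) y \<or> fst x = fst y)"
      consider "x = (i, v)" "y \<in> dom (sched s)" | "y = (i, v)" "x \<in> dom (sched s)"
        | "x \<in> dom (sched s)" "y \<in> dom (sched s)" "x \<noteq> (i, v)" "y \<noteq> (i, v)"
        using xy * new unfolding dom' by blast
      then show "disjnt {start_of (sched ?s) x ..< end_of I (sched ?s) x}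
               {start_of (sched ?s) y ..< end_of I (sched ?s) y}"
      proof cases
        case 1
        then have "end_of I (sched s) y \<le> time s" using old[of y] * Process by auto
        then show ?thesis using 1 * Process by (auto intro: disjnt_later_interval)
      next
        case 2
        then have "end_of I (sched s) x \<le> time s" using old[of x] * Process by auto
        then show ?thesis using 2 * Process by (auto intro: disjnt_later_interval)
      next
        case 3
        then have "disjnt {start_of (sched s) x ..< end_of I (sched s) x}
               {start_of (sched s) y ..< end_of I (sched s) y}"
          using partial_solutionD(5)[OF s] * Process by simp
        then show ?thesis using 3 Process by simp
      qed
    qed
  qed
qed

lemma partial_solution_run:
  assumes "ipps_instance I" "combination_choice I C"
    and "admissible I initial_state as"
    and "dom (sched (run I initial_state as)) \<subseteq> Sigma (jobs I) C"
  shows "partial_solution I C (run I initial_state as)"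
  using assms(3,4)
proof (induction as rule: rev_induct)
  case Nil
  then show ?case by (simp add: partial_solution_def initial_state_def)
next
  case (snoc a as)
  have "dom (sched (run I initial_state as)) \<subseteq> Sigma (jobs I) C"
    using snoc.prems(2) dom_transition_mono[of "run I initial_state as" I a] by simp
  then show ?case
    using snoc partial_solution_transition[OF assms(1,2), of "run I initial_state as" a]
    by (simp add: admissible_append)
qed

lemma process_in_all_ops: "available I s (Process i v k) \<Longrightarrow> (i, v) \<in> all_ops I"
  using feasible_in_opers[of I s i v] by (simp add: all_ops_def)

lemma dom_run_subset_all_ops:
  assumes "admissible I initial_state as"
  shows "dom (sched (run I initial_state as)) \<subseteq> all_ops I"
  using assms
proof (induction as rule: rev_induct)
  case Nil
  then show ?case by (simp add: initial_state_def)
next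
  case (snoc a as)
  let ?s = "run I initial_state as"
  have "dom (sched ?s) \<subseteq> all_ops I" and a: "available I ?s a"
    using snoc by (simp_all add: admissible_append)
  then have "dom (sched (transition I ?s a)) \<subseteq> all_ops I"
    using process_in_all_ops[of I ?s] by (cases a) auto
  then show ?case by simp
qed

lemma complete_trajectory_ipps_schedule:
  assumes inst: "ipps_instance I" and \<tau>: "complete_trajectory I \<tau>"
  shows "ipps_schedule I (generated_schedule I \<tau>)"
proof -
  define s where "s = run I initial_state \<tau>"
  define C where "C = scheduled_ops s"
  have adm: "admissible I initial_state \<tau>" and C: "combination_choice I C"
    using \<tau> by (auto simp: complete_trajectory_def combination_choice_def C_def s_def final_state_def)
  have dom: "dom (sched s) = Sigma (jobs I) C"
    using dom_run_subset_all_ops[OF adm] unfolding C_def scheduled_ops_def all_ops_def s_def by auto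
  then have ps: "partial_solution I C s"
    using partial_solution_run[OF inst C adm] by (simp add: s_def)
  have "ipps_solution I C (sched s)"
    unfolding ipps_solution_def
  proof (intro conjI)
    show "\<forall>i \<in> jobs I. C i \<in> combinations (graph I i)"
      using C by (simp add: combination_choice_def)
    show "dom (sched s) = Sigma (jobs I) C" by (rule dom)
    show "\<forall>x \<in> dom (sched s). machine_of (sched s) x \<in> op_machines I (fst x) (snd x) \<and>
        start_of (sched s) x \<ge> 0"
      by (rule partial_solutionD(3)[OF ps])
    show "\<forall>i \<in> jobs I. \<forall>u \<in> C i. \<forall>v \<in> C i. (Op u, Op v) \<in> arcs (graph I i) \<longrightarrow>
        end_of I (sched s) (i, u) \<le> start_of (sched s) (i, v)"
      using partial_solutionD(4)[OF ps] dom by simp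
  qed (use partial_solutionD(5)[OF ps] in blast)+
  then show ?thesis
    unfolding ipps_schedule_def generated_schedule_def final_state_def s_def by blast
qed


section \<open>Every IPPS schedule is dominated by a trajectory\<close>

lemma wait_until:
  assumes "finite (dom (sched s))" "time s \<le> T"
  shows "\<exists>as t. admissible I s as \<and> run I s as = s\<lparr>time := t\<rparr> \<and> t \<le> T \<and>
    (\<forall>x \<in> dom (sched s). end_of I (sched s) x \<le> T \<longrightarrow> end_of I (sched s) x \<le> t)"
  using assms
proof (induction "card {e \<in> pending_ends I s. e \<le> T}" arbitrary: s rule: less_induct)
  case less
  show ?case
  proof (cases "{e \<in> pending_ends I s. e \<le> T} = {}")
    case True
    then have "\<forall>x \<in> dom (sched s). end_of I (sched s) x \<le> T \<longrightarrow> end_of I (sched s) x \<le> time s"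
      by (force simp: pending_ends_def)
    then show ?thesis using less.prems by (intro exI[of _ "[]"] exI[of _ "time s"]) simp
  next
    case False
    then obtain e where e: "e \<in> pending_ends I s" "e \<le> T" by blast
    let ?t = "Min (pending_ends I s)"
    let ?s = "s\<lparr>time := ?t\<rparr>"
    have fin: "finite (pending_ends I s)" using less.prems finite_pending_ends by blast
    have "?t \<le> T" using e Min_le[OF fin e(1)] by simp
    have t: "?t \<in> pending_ends I s" using Min_in[OF fin] e by blast
    have "{e \<in> pending_ends I ?s. e \<le> T} \<subset> {e \<in> pending_ends I s. e \<le> T}"
      using t \<open>?t \<le> T\<close> unfolding pending_ends_def by auto
    then have "card {e \<in> pending_ends I ?s. e \<le> T} < card {e \<in> pending_ends I s. e \<le> T}"
      using fin by (intro psubset_card_mono) auto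
    then obtain as t' where "admissible I ?s as" "run I ?s as = ?s\<lparr>time := t'\<rparr>" "t' \<le> T"
      "\<forall>x \<in> dom (sched s). end_of I (sched s) x \<le> T \<longrightarrow> end_of I (sched s) x \<le> t'"
      using less.hyps[of ?s] less.prems \<open>?t \<le> T\<close> by auto
    then show ?thesis using e by (intro exI[of _ "Wait # as"] exI[of _ t']) auto
  qed
qed

definition no_later :: "('j, 'o, 'm) sched \<Rightarrow> ('j, 'o, 'm) sched \<Rightarrow> bool" where
  "no_later S' S \<longleftrightarrow> (\<forall>x \<in> dom S'. machine_of S' x = machine_of S x \<and> start_of S' x \<le> start_of S x)"

lemma no_later_end: "no_later S' S \<Longrightarrow> x \<in> dom S' \<Longrightarrow> end_of I S' x \<le> end_of I S x"
  by (simp add: no_later_def end_of_def)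

lemma interval_before:
  fixes a b t e :: real
  assumes "disjnt {a ..< b} {t ..< e}" "a \<le> t" "t < e"
  shows "b \<le> t"
proof (rule ccontr)
  assume "\<not> b \<le> t"
  then have "t \<in> {a ..< b}" "t \<in> {t ..< e}" using assms by auto
  then show False using assms(1) by (auto simp: disjnt_def)
qed

lemma ipps_solutionD:
  assumes "ipps_solution I C S"
  shows "combination_choice I C" "dom S = Sigma (jobs I) C"
    and "\<forall>x \<in> dom S. machine_of S x \<in> op_machines I (fst x) (snd x) \<and> start_of S x \<ge> 0"
    and "\<forall>i \<in> jobs I. \<forall>u \<in> C i. \<forall>v \<in> C i.
        (Op u, Op v) \<in> arcs (graph I i) \<longrightarrow> end_of I S (i, u) \<le> start_of S (i, v)"
    and "\<forall>x \<in> dom S. \<forall>y \<in> dom S. x \<noteq> y \<and> machine_of S x = machine_of S y \<longrightarrow>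
        disjnt {start_of S x ..< end_of I S x} {start_of S y ..< end_of I S y}"
    and "\<forall>x \<in> dom S. \<forall>y \<in> dom S. x \<noteq> y \<and> fst x = fst y \<longrightarrow>
        disjnt {start_of S x ..< end_of I S x} {start_of S y ..< end_of I S y}"
  using assms unfolding ipps_solution_def combination_choice_def by - (elim conjE, assumption)+

lemma ipps_solution_finite:
  assumes "ipps_instance I" "ipps_solution I C S"
  shows "finite (dom S)"
  using combination_choice_subset_all_ops[OF ipps_solutionD(1)[OF assms(2)]]
    finite_all_ops[OF assms(1)] ipps_solutionD(2)[OF assms(2)] by (simp add: finite_subset)

text \<open>
  The induction adds the unscheduled operation \<open>x\<close> that \<open>S\<close> starts first, at time \<open>T\<close>.  In \<open>S\<close>, and hence
  in the run, everything that blocks \<open>x\<close> has ended by time \<open>T\<close>.  So after waiting as long as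
  possible without passing \<open>T\<close>, nothing blocks \<open>x\<close> any more.
\<close>

lemma follow_schedule:
  assumes inst: "ipps_instance I" and sol: "ipps_solution I C S"
  shows "dom (sched s) \<subseteq> dom S \<Longrightarrow> no_later (sched s) S \<Longrightarrow>
    (\<And>y. y \<in> dom S - dom (sched s) \<Longrightarrow> time s \<le> start_of S y) \<Longrightarrow>
    (\<And>x y. x \<in> dom (sched s) \<Longrightarrow> y \<in> dom S - dom (sched s) \<Longrightarrow> start_of S x \<le> start_of S y) \<Longrightarrow>
    \<exists>as. admissible I s as \<and> dom (sched (run I s as)) = dom S \<and> no_later (sched (run I s as)) S"
proof (induction "card (dom S - dom (sched s))" arbitrary: s rule: less_induct)
  case less
  note C = ipps_solutionD(1)[OF sol] and domS = ipps_solutionD(2)[OF sol]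
  note finS = ipps_solution_finite[OF inst sol]
  show ?case
  proof (cases "dom S - dom (sched s) = {}")
    case True
    then show ?thesis using less.prems(1,2) by (intro exI[of _ "[]"]) auto
  next
    case False
    obtain x where x: "x \<in> dom S - dom (sched s)"
      and first: "\<And>y. y \<in> dom S - dom (sched s) \<Longrightarrow> start_of S x \<le> start_of S y"
      using ex_is_arg_min_if_finite[of "dom S - dom (sched s)" "start_of S"] finS False
      by (auto simp: is_arg_min_linorder)
    obtain i v where iv: "x = (i, v)" by (cases x)
    let ?T = "start_of S x"
    let ?k = "machine_of S x"
    have i: "i \<in> jobs I" and v: "v \<in> C i" using x iv domS by auto
    have k: "?k \<in> op_machines I i v" using bspec[OF ipps_solutionD(3)[OF sol], of x] x iv by simp
    have "v \<in> opers (graph I i)"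
      using combination_subset_opers C i v by (auto simp: combination_choice_def)
    then have "ptime I i v ?k > 0" using inst i k by (simp add: ipps_instance_def)
    then have Tpos: "?T < end_of I S x" by (simp add: end_of_def iv)
    have fin: "finite (dom (sched s))" using finS less.prems(1) finite_subset by blast
    obtain as t where as: "admissible I s as" "run I s as = s\<lparr>time := t\<rparr>" "t \<le> ?T"
      and waited: "\<And>y. y \<in> dom (sched s) \<Longrightarrow> end_of I (sched s) y \<le> ?T \<Longrightarrow> end_of I (sched s) y \<le> t"
      using wait_until[OF fin less.prems(3)[OF x]] by blast
    let ?s = "s\<lparr>time := t\<rparr>"
    have ended: "end_of I (sched s) y \<le> t" if "y \<in> dom (sched s)" "end_of I S y \<le> ?T" for y
      using waited[of y] no_later_end[OF less.prems(2) that(1), of I] that by simp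
    have blocking: "end_of I (sched s) y \<le> t"
      if y: "y \<in> dom (sched s)" and "machine_of S y = ?k \<or> fst y = i" for y
    proof -
      have "disjnt {start_of S y ..< end_of I S y} {?T ..< end_of I S x}"
        using ipps_solutionD(5,6)[OF sol] x y that(2) less.prems(1) iv by (metis DiffD1 DiffD2 fst_conv subsetD)
      then show ?thesis
        using interval_before[OF _ less.prems(4)[OF y x] Tpos] ended[OF y] by blast
    qed
    have "feasible I ?s i v"
    proof (rule feasible_in_combination[OF instance_graph_wf[OF inst i]])
      show "C i \<in> combinations (graph I i)" using C i by (simp add: combination_choice_def)
      show "scheduled_ops ?s i \<subseteq> C i"
        using less.prems(1) domS by (auto simp: scheduled_ops_def)
      show "v \<in> C i" by (rule v)
      show "v \<notin> scheduled_ops ?s i" using x iv by (auto simp: scheduled_ops_def)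
      fix u assume u: "u \<in> C i" "(Op u, Op v) \<in> arcs (graph I i)"
      have end_u: "end_of I S (i, u) \<le> ?T"
        using ipps_solutionD(4)[OF sol] i u v iv by simp
      have uS: "(i, u) \<in> dom S" using u i domS by simp
      have "u \<in> opers (graph I i)"
        using combination_subset_opers C i u by (auto simp: combination_choice_def)
      moreover have "machine_of S (i, u) \<in> op_machines I i u"
        using bspec[OF ipps_solutionD(3)[OF sol] uS] by simp
      ultimately have "ptime I i u (machine_of S (i, u)) > 0"
        using inst i by (simp add: ipps_instance_def)
      \<comment> \<open>Processing times are positive, so \<open>S\<close> starts \<open>u\<close> strictly before \<open>v\<close>.\<close>
      then have "start_of S (i, u) < ?T" using end_u by (simp add: end_of_def)
      then have "(i, u) \<in> dom (sched s)" using first[of "(i, u)"] uS by force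
      then show "u \<in> scheduled_ops ?s i \<and> end_of I (sched ?s) (i, u) \<le> time ?s"
        using ended end_u by (auto simp: scheduled_ops_def)
    qed
    moreover have "machine_idle I ?s ?k" "job_idle I ?s i"
      using blocking less.prems(2) by (auto simp: machine_idle_def job_idle_def no_later_def)
    ultimately have avail: "available I ?s (Process i v ?k)" using i k by simp
    let ?s' = "transition I ?s (Process i v ?k)"
    have dom': "dom (sched ?s') = insert x (dom (sched s))" using iv by auto
    have "dom S - dom (sched ?s') \<subset> dom S - dom (sched s)" unfolding dom' using x by blast
    then have "card (dom S - dom (sched ?s')) < card (dom S - dom (sched s))"
      using finS by (intro psubset_card_mono) auto
    moreover have "dom (sched ?s') \<subseteq> dom S" unfolding dom' using x less.prems(1) by blast
    moreover have "no_later (sched ?s') S"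
      using less.prems(2) as(3) iv by (auto simp: no_later_def)
    moreover have "time ?s' \<le> start_of S y" if "y \<in> dom S - dom (sched ?s')" for y
    proof -
      have "?T \<le> start_of S y" using first that unfolding dom' by blast
      then show ?thesis using as(3) by simp
    qed
    moreover have "start_of S z \<le> start_of S y"
      if "z \<in> dom (sched ?s')" "y \<in> dom S - dom (sched ?s')" for z y
      using that first less.prems(4) unfolding dom' by blast
    ultimately obtain bs where bs: "admissible I ?s' bs" "dom (sched (run I ?s' bs)) = dom S"
      "no_later (sched (run I ?s' bs)) S"
      using less.hyps[of ?s'] by blast
    have "admissible I s (as @ Process i v ?k # bs)"
      using as(1,2) avail bs(1) by (simp add: admissible_append del: available.simps)
    moreover have "run I s (as @ Process i v ?k # bs) = run I ?s' bs" using as(2) by simp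
    ultimately show ?thesis using bs by metis
  qed
qed

lemma makespan_mono:
  assumes "dom S' = dom S" "no_later S' S" "finite (dom S)" "dom S \<noteq> {}"
  shows "makespan I S' \<le> makespan I S"
  unfolding makespan_def
proof (rule Max.boundedI)
  fix e assume "e \<in> end_of I S' ` dom S'"
  then obtain x where x: "x \<in> dom S'" "e = end_of I S' x" by blast
  have "end_of I S x \<le> Max (end_of I S ` dom S)" using assms x by simp
  then show "e \<le> Max (end_of I S ` dom S)"
    using no_later_end[OF assms(2) x(1), of I] x(2) by simp
qed (use assms in auto)

lemma complete_trajectoryI:
  assumes "combination_choice I C" "admissible I initial_state \<tau>"
    and "dom (generated_schedule I \<tau>) = Sigma (jobs I) C"
  shows "complete_trajectory I \<tau>"
proof -
  have "scheduled_ops (final_state I \<tau>) i = C i" if "i \<in> jobs I" for i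
    using assms(3) that by (simp add: scheduled_ops_def generated_schedule_def)
  then show ?thesis using assms by (simp add: complete_trajectory_def combination_choice_def)
qed

lemma ipps_schedule_dominated:
  assumes inst: "ipps_instance I" and S: "ipps_schedule I S"
  shows "\<exists>\<tau>. complete_trajectory I \<tau> \<and> trajectory_makespan I \<tau> \<le> makespan I S"
proof -
  obtain C where sol: "ipps_solution I C S" using S by (auto simp: ipps_schedule_def)
  note C = ipps_solutionD(1)[OF sol] and domS = ipps_solutionD(2)[OF sol]
  have "finite (dom S)" using ipps_solution_finite[OF inst sol] .
  moreover have "dom S \<noteq> {}"
    using inst C domS by (fastforce simp: ipps_instance_def combination_choice_def)
  moreover obtain \<tau> where \<tau>: "admissible I initial_state \<tau>"
    "dom (sched (run I initial_state \<tau>)) = dom S" "no_later (sched (run I initial_state \<tau>)) S"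
    using follow_schedule[OF inst sol, of initial_state] ipps_solutionD(3)[OF sol]
    by (auto simp: initial_state_def no_later_def)
  ultimately have "trajectory_makespan I \<tau> \<le> makespan I S"
    by (simp add: trajectory_makespan_def generated_schedule_def final_state_def makespan_mono)
  moreover have "complete_trajectory I \<tau>"
    using complete_trajectoryI[OF C \<tau>(1)] \<tau>(2) domS by (simp add: generated_schedule_def final_state_def)
  ultimately show ?thesis by blast
qed


section \<open>Existence of optimal trajectories\<close>

text \<open>
  Starting an operation may create one pending end time, so an unscheduled operation counts twice.
\<close>

definition potential :: "('j, 'o, 'm) ipps \<Rightarrow> ('j, 'o, 'm) mdp_state \<Rightarrow> nat" where
  "potential I s = 2 * card (all_ops I - dom (sched s)) + card (pending_ends I s)"

lemma potential_decreases:
  assumes inst: "ipps_instance I" and sub: "dom (sched s) \<subseteq> all_ops I" and a: "available I s a"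
  shows "dom (sched (transition I s a)) \<subseteq> all_ops I \<and> potential I (transition I s a) < potential I s"
proof -
  have fin: "finite (dom (sched s))" using finite_subset[OF sub finite_all_ops[OF inst]] .
  show ?thesis
  proof (cases a)
    case Wait
    let ?t = "Min (pending_ends I s)"
    have t: "?t \<in> pending_ends I s" using wait_time[OF fin] a Wait by blast
    then have "pending_ends I (transition I s a) \<subset> pending_ends I s"
      using pending_ends_later Wait by simp
    then have "card (pending_ends I (transition I s a)) < card (pending_ends I s)"
      using finite_pending_ends[OF fin] by (rule psubset_card_mono[rotated])
    then show ?thesis using sub Wait by (simp add: potential_def)
  next
    case (Process i v k)
    have new: "(i, v) \<in> all_ops I - dom (sched s)"
      using a Process process_in_all_ops[of I s i v] by (auto simp: feasible_def scheduled_ops_def)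
    let ?s = "transition I s a"
    have dom': "dom (sched ?s) = insert (i, v) (dom (sched s))" using Process by auto
    have "all_ops I - dom (sched ?s) = (all_ops I - dom (sched s)) - {(i, v)}"
      unfolding dom' by blast
    then have "card (all_ops I - dom (sched s)) = Suc (card (all_ops I - dom (sched ?s)))"
      using card.remove[OF _ new] finite_all_ops[OF inst] by simp
    moreover have "card (pending_ends I ?s) \<le> Suc (card (pending_ends I s))"
    proof -
      let ?new = "time s + ptime I i v k"
      have "pending_ends I ?s \<subseteq> insert ?new (pending_ends I s)"
        using Process unfolding pending_ends_def dom' by auto
      then have "card (pending_ends I ?s) \<le> card (insert ?new (pending_ends I s))"
        using finite_pending_ends[OF fin] by (intro card_mono) auto
      also have "\<dots> \<le> Suc (card (pending_ends I s))"
        using finite_pending_ends[OF fin] by (simp add: card_insert_if)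
      finally show ?thesis .
    qed
    ultimately show ?thesis using sub new unfolding dom' potential_def by auto
  qed
qed

lemma admissible_length:
  assumes "ipps_instance I"
  shows "dom (sched s) \<subseteq> all_ops I \<Longrightarrow> admissible I s as \<Longrightarrow> length as \<le> potential I s"
proof (induction as arbitrary: s)
  case (Cons a as)
  then show ?case using potential_decreases[OF assms, of s a] by fastforce
qed simp

lemma finite_admissible:
  assumes inst: "ipps_instance I"
  shows "finite {as. admissible I initial_state as}"
proof -
  define A where "A = insert Wait
    ((\<lambda>((i, v), k). Process i v k) ` (all_ops I \<times> machines I))"
  have "finite A"
    using inst finite_all_ops[OF inst] by (simp add: A_def ipps_instance_def)
  have in_A: "a \<in> A" if "available I s a" for s a
  proof (cases a)
    case (Process i v k)
    have "(i, v) \<in> all_ops I" using that Process process_in_all_ops[of I s i v k] by simp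
    moreover from this have "k \<in> machines I"
      using that Process inst by (auto simp: ipps_instance_def all_ops_def)
    ultimately show ?thesis using Process by (force simp: A_def)
  qed (simp add: A_def)
  have "set as \<subseteq> A" if "admissible I s as" for s as
    using that by (induction as arbitrary: s) (auto dest: in_A)
  moreover have "length as \<le> potential I initial_state" if "admissible I initial_state as" for as
    using admissible_length[OF inst _ that] by (simp add: initial_state_def)
  ultimately have "{as. admissible I initial_state as} \<subseteq>
      {as. set as \<subseteq> A \<and> length as \<le> potential I initial_state}" by blast
  then show ?thesis using finite_lists_length_le[OF \<open>finite A\<close>] finite_subset by blast
qed

text \<open>
  If no operation is in progress, then an unscheduled operation of the combination that is minimal
  with respect to the arcs can be started.
\<close>

lemma trajectory_progress:
  assumes inst: "ipps_instance I" and C: "combination_choice I C"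
    and sub: "dom (sched s) \<subset> Sigma (jobs I) C"
  shows "\<exists>a. available I s a \<and> dom (sched (transition I s a)) \<subseteq> Sigma (jobs I) C"
proof (cases "pending_ends I s = {}")
  case False
  then show ?thesis using sub by (intro exI[of _ Wait]) auto
next
  case True
  then have ended: "end_of I (sched s) x \<le> time s" if "x \<in> dom (sched s)" for x
    using that by (force simp: pending_ends_def)
  obtain i v0 where i: "i \<in> jobs I" and v0: "v0 \<in> C i - scheduled_ops s i"
    using sub by (auto simp: scheduled_ops_def)
  let ?G = "graph I i"
  have wfG: "wf_and_or_graph ?G" using instance_graph_wf[OF inst i] .
  then have "finite (nodes ?G)" by (simp add: nodes_def wf_and_or_graph_def)
  then have "finite (arcs ?G)"
    using wfG by (auto simp: wf_and_or_graph_def intro: finite_subset)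
  then have "wf (arcs ?G)" using wfG by (simp add: wf_and_or_graph_def finite_acyclic_wf)
  then obtain z where z: "z \<in> Op ` (C i - scheduled_ops s i)"
    and min: "\<And>y. (y, z) \<in> arcs ?G \<Longrightarrow> y \<notin> Op ` (C i - scheduled_ops s i)"
    using v0 by (rule_tac wfE_min[of "arcs ?G" "Op v0" "Op ` (C i - scheduled_ops s i)"]) auto
  obtain v where v: "v \<in> C i" "v \<notin> scheduled_ops s i" "z = Op v" using z by blast
  have Ci: "C i \<in> combinations ?G" using C i by (simp add: combination_choice_def)
  have "feasible I s i v"
  proof (rule feasible_in_combination[OF wfG Ci _ v(1,2)])
    show "scheduled_ops s i \<subseteq> C i" using sub by (auto simp: scheduled_ops_def)
    fix u assume "u \<in> C i" "(Op u, Op v) \<in> arcs ?G"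
    then have "u \<in> scheduled_ops s i" using min[of "Op u"] v(3) by blast
    then show "u \<in> scheduled_ops s i \<and> end_of I (sched s) (i, u) \<le> time s"
      using ended by (auto simp: scheduled_ops_def)
  qed
  moreover obtain k where "k \<in> op_machines I i v"
    using inst i v(1) combination_subset_opers[OF Ci] unfolding ipps_instance_def by blast
  ultimately have "available I s (Process i v k)"
    using i ended by (simp add: machine_idle_def job_idle_def)
  then show ?thesis using sub i v by (intro exI[of _ "Process i v k"]) auto
qed

lemma complete_trajectory_exists:
  assumes inst: "ipps_instance I"
  shows "\<exists>\<tau>. complete_trajectory I \<tau>"
proof -
  have "\<exists>C. \<forall>i \<in> jobs I. C i \<in> combinations (graph I i)"
    using combination_exists[OF instance_graph_wf[OF inst]] by (intro bchoice) blast
  then obtain C where C: "combination_choice I C" by (auto simp: combination_choice_def)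
  let ?P = "\<lambda>\<tau>. admissible I initial_state \<tau> \<and> dom (generated_schedule I \<tau>) \<subseteq> Sigma (jobs I) C"
  have "?P []" by (simp add: generated_schedule_def final_state_def initial_state_def)
  moreover have "length \<tau> \<le> potential I initial_state" if "?P \<tau>" for \<tau>
    using admissible_length[OF inst, of initial_state \<tau>] that by (simp add: initial_state_def)
  then have "\<forall>\<tau>. ?P \<tau> \<longrightarrow> length \<tau> < Suc (potential I initial_state)" by (simp add: less_Suc_eq_le)
  ultimately obtain \<tau> where \<tau>: "?P \<tau>" and longest: "\<And>\<tau>'. ?P \<tau>' \<Longrightarrow> length \<tau>' \<le> length \<tau>"
    using ex_has_greatest_nat[of ?P "[]" length "Suc (potential I initial_state)"] by blast
  have "dom (generated_schedule I \<tau>) = Sigma (jobs I) C"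
  proof (rule ccontr)
    assume "dom (generated_schedule I \<tau>) \<noteq> Sigma (jobs I) C"
    then have "dom (sched (final_state I \<tau>)) \<subset> Sigma (jobs I) C"
      using \<tau> by (auto simp: generated_schedule_def)
    then obtain a where "available I (final_state I \<tau>) a"
      "dom (sched (transition I (final_state I \<tau>) a)) \<subseteq> Sigma (jobs I) C"
      using trajectory_progress[OF inst C] by blast
    then have "?P (\<tau> @ [a])"
      using \<tau> by (simp add: admissible_append generated_schedule_def final_state_def)
    then show False using longest[of "\<tau> @ [a]"] by simp
  qed
  then show ?thesis using complete_trajectoryI[OF C] \<tau> by blast
qed

lemma optimal_trajectory_exists:
  assumes inst: "ipps_instance I"
  shows "\<exists>\<tau>. optimal_trajectory I \<tau>"
proof -
  have "finite {\<tau>. complete_trajectory I \<tau>}"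
    using finite_subset[OF _ finite_admissible[OF inst]] by (auto simp: complete_trajectory_def)
  moreover have "{\<tau>. complete_trajectory I \<tau>} \<noteq> {}" using complete_trajectory_exists[OF inst] by blast
  ultimately have "\<exists>\<tau>. is_arg_min (trajectory_makespan I) (\<lambda>\<tau>. \<tau> \<in> {\<tau>. complete_trajectory I \<tau>}) \<tau>"
    by (rule ex_is_arg_min_if_finite)
  then show ?thesis by (simp add: optimal_trajectory_def)
qed


section \<open>Equivalence of the optimal solutions\<close>

theorem theorem1:
  fixes I :: "('j, 'o, 'm) ipps"
  assumes "ipps_instance I"
  shows "(\<exists>S \<tau>. optimal_schedule I S \<and> optimal_trajectory I \<tau> \<and>
            makespan I S = trajectory_makespan I \<tau>) \<and>
         (\<forall>\<tau>. complete_trajectory I \<tau> \<longrightarrow>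
            (optimal_trajectory I \<tau> \<longleftrightarrow> optimal_schedule I (generated_schedule I \<tau>)))"
proof -
  have sound: "ipps_schedule I (generated_schedule I \<tau>)" if "complete_trajectory I \<tau>" for \<tau>
    using complete_trajectory_ipps_schedule[OF assms that] .
  have equiv: "optimal_trajectory I \<tau> \<longleftrightarrow> optimal_schedule I (generated_schedule I \<tau>)"
    if \<tau>: "complete_trajectory I \<tau>" for \<tau>
  proof
    assume opt: "optimal_trajectory I \<tau>"
    have "trajectory_makespan I \<tau> \<le> makespan I S" if S: "ipps_schedule I S" for S
    proof -
      obtain \<tau>' where "complete_trajectory I \<tau>'" "trajectory_makespan I \<tau>' \<le> makespan I S"
        using ipps_schedule_dominated[OF assms S] by blast
      then show ?thesis using opt
        unfolding optimal_trajectory_def is_arg_min_linorder by fastforce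
    qed
    then show "optimal_schedule I (generated_schedule I \<tau>)"
      using sound[OF \<tau>] by (simp add: optimal_schedule_def is_arg_min_linorder trajectory_makespan_def)
  next
    assume "optimal_schedule I (generated_schedule I \<tau>)"
    then show "optimal_trajectory I \<tau>"
      using \<tau> sound
      by (simp add: optimal_schedule_def optimal_trajectory_def is_arg_min_linorder trajectory_makespan_def)
  qed
  obtain \<tau> where \<tau>: "optimal_trajectory I \<tau>" using optimal_trajectory_exists[OF assms] by blast
  then have "complete_trajectory I \<tau>" by (simp add: optimal_trajectory_def is_arg_min_def)
  then have "optimal_schedule I (generated_schedule I \<tau>)" using equiv \<tau> by blast
  moreover have "makespan I (generated_schedule I \<tau>) = trajectory_makespan I \<tau>"
    by (simp add: trajectory_makespan_def)
  ultimately show ?thesis using \<tau> equiv by blast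
qed

end
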